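(* For every even integer $n\ge 0$, the polynomial $\frac{1-q^{3n+1}}{1-q}C_n(q)$ is symmetric and unimodal (its coefficient sequence is palindromic and weakly increases up to its middle and weakly decreases afterwards).
   Context: The $q$-Catalan polynomial is $C_n(q)=\frac{1-q}{1-q^{n+1}}{2n\brack n}$, where ${n\brack m}=\prod_{i=0}^{m-1}\frac{1-q^{n-i}}{1-q^{m-i}}$ is the Gaussian polynomial; $C_n(q)$ is a polynomial in $q$. *)

theory Defs
  imports "HOL-Computational_Algebra.Polynomial"
begin

abbreviation qX :: "rat poly" where "qX \<equiv> [:0, 1:]"

text \<open>Gaussian polynomial [n, m] = prod_{i<m} (1 - q^(n-i)) / (1 - q^(m-i)).
  The division is exact polynomial division over the field of rationals.\<close>
definition gauss_poly :: "nat \<Rightarrow> nat \<Rightarrow> rat poly" where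
  "gauss_poly n m =
     (\<Prod>i<m. 1 - qX ^ (n - i)) div (\<Prod>i<m. 1 - qX ^ (m - i))"

definition q_catalan :: "nat \<Rightarrow> rat poly" where
  "q_catalan n = ((1 - qX) * gauss_poly (2 * n) n) div (1 - qX ^ (n + 1))"

definition symmetric_poly :: "rat poly \<Rightarrow> bool" where
  "symmetric_poly p \<longleftrightarrow> (\<forall>i \<le> degree p. coeff p i = coeff p (degree p - i))"

definition unimodal_poly :: "rat poly \<Rightarrow> bool" where
  "unimodal_poly p \<longleftrightarrow>
     (\<exists>m \<le> degree p. (\<forall>i < m. coeff p i \<le> coeff p (i + 1)) \<and>
                    (\<forall>i. m \<le> i \<and> i < degree p \<longrightarrow> coeff p (i + 1) \<le> coeff p i))"

end

theory Submission
  imports Defs "HOL-Library.Poly_Mapping"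
begin

text \<open>For even \<open>n \<ge> 2\<close> the polynomial in question equals the difference
  \<open>[2n+2, n] - q^(n+2) [2n, n-2]\<close> of Gaussian polynomials. With \<open>N = n + 2\<close>, these two terms are the
  weight generating functions of the homogeneous polynomials of degree \<open>n\<close> and \<open>n - 2\<close> in variables
  \<open>x\<^sub>0, \<dots>, x\<^sub>N\<close>, where \<open>x\<^sub>i\<close> has weight \<open>i\<close>. The Lie algebra sl(2) acts on them by the derivations
  \<open>Dn: x\<^sub>i \<mapsto> i x\<^sub>i\<^sub>-\<^sub>1\<close> and \<open>Up: x\<^sub>i \<mapsto> (N - i) x\<^sub>i\<^sub>+\<^sub>1\<close>, and since \<open>N\<close> is even there is a nonzero invariant
  quadratic form \<open>Q\<close>. Multiplication by \<open>Q\<close> embeds degree \<open>n - 2\<close> into degree \<open>n\<close> as a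
  subrepresentation, so the difference is the character of the quotient, and characters of sl(2) whose
  weights have the same parity are unimodal (compare Reiner and Stanton, Unimodality of differences of
  specialized Schur functions).\<close>

subsection \<open>Homogeneous polynomials and derivations\<close>

type_synonym mpoly = "(nat \<Rightarrow>\<^sub>0 nat) \<Rightarrow>\<^sub>0 rat"

abbreviation keys where "keys \<equiv> Poly_Mapping.keys"
abbreviation lookup where "lookup \<equiv> Poly_Mapping.lookup"
abbreviation single where "single \<equiv> Poly_Mapping.single"

text \<open>Degree and weight are both instances, so facts such as additivity are proved once for
  the two gradings.\<close>

definition wsum :: "(nat \<Rightarrow> nat) \<Rightarrow> (nat \<Rightarrow>\<^sub>0 nat) \<Rightarrow> nat" where
  "wsum w m = (\<Sum>i\<in>keys m. w i * lookup m i)"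

abbreviation mdeg where "mdeg \<equiv> wsum (\<lambda>_. 1)"
abbreviation weight where "weight \<equiv> wsum (\<lambda>i. i)"

lemma wsum_add: "wsum w (m + m') = wsum w m + wsum w m'"
  unfolding wsum_def by (rule setsum_keys_plus_distrib) (simp_all add: algebra_simps)

lemma wsum_0 [simp]: "wsum w 0 = 0"
  by (simp add: wsum_def)

lemma wsum_single [simp]: "wsum w (single i c) = w i * c"
  by (simp add: wsum_def)

lemma keys_add_nat: "keys (m + m' :: nat \<Rightarrow>\<^sub>0 nat) = keys m \<union> keys m'"
  by (auto simp: in_keys_iff lookup_add)

lemma minus_single_add:
  assumes "i \<in> keys (m :: nat \<Rightarrow>\<^sub>0 nat)"
  shows "m - single i 1 + single i 1 = m"
  using assms
  by (intro poly_mapping_eqI) (auto simp: lookup_add lookup_minus lookup_single when_def in_keys_iff)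

lemma mdeg_eq_0_iff: "mdeg m = 0 \<longleftrightarrow> m = 0"
  by (auto simp: wsum_def in_keys_iff intro!: poly_mapping_eqI)

definition mons :: "nat \<Rightarrow> nat \<Rightarrow> nat \<Rightarrow> (nat \<Rightarrow>\<^sub>0 nat) set" where
  "mons N k w = {m. keys m \<subseteq> {..N} \<and> mdeg m = k \<and> weight m = w}"

abbreviation hom :: "nat \<Rightarrow> nat \<Rightarrow> nat \<Rightarrow> mpoly \<Rightarrow> bool" where
  "hom N k w p \<equiv> keys p \<subseteq> mons N k w"

lemma hom_add: "hom N k w p \<Longrightarrow> hom N k w r \<Longrightarrow> hom N k w (p + r)"
  using keys_add[of p r] by blast

lemma hom_sum: "(\<And>x. x \<in> S \<Longrightarrow> hom N k w (f x)) \<Longrightarrow> hom N k w (\<Sum>x\<in>S. f x)"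
  by (induction S rule: infinite_finite_induct) (use hom_add in auto)

lemma hom_mult: "hom N k w p \<Longrightarrow> hom N k' w' r \<Longrightarrow> hom N (k + k') (w + w') (p * r)"
  using keys_mult[of p r] by (fastforce simp: mons_def wsum_add keys_add_nat)

lemma hom_const: "hom N 0 0 (single 0 c)"
  by (simp add: mons_def)

lemma hom_of_nat: "hom N 0 0 (of_nat c)"
  using hom_const[of "of_nat c"] by simp

definition X :: "nat \<Rightarrow> mpoly" where "X i = single (single i 1) 1"

lemma hom_X: "i \<le> N \<Longrightarrow> hom N 1 i (X i)"
  by (simp add: X_def mons_def)

text \<open>Splitting off each coefficient as a constant factor suits derivations, which commute
  with constants: linear statements reduce to monomials with coefficient 1.\<close>

lemma monomial_sum: "p = (\<Sum>m\<in>keys p. single 0 (lookup p m) * single m (1::rat))"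
proof (rule poly_mapping_eqI)
  fix m
  have "lookup (\<Sum>m\<in>keys p. single m (lookup p m)) m = lookup p m"
    by (auto simp: lookup_sum lookup_single when_def in_keys_iff)
  thus "lookup p m = lookup (\<Sum>m\<in>keys p. single 0 (lookup p m) * single m 1) m"
    by (simp add: mult_single)
qed

text \<open>\<open>dmon d\<close> is the restriction to monomials of the derivation \<open>der d\<close> with \<open>x\<^sub>i \<mapsto> d i\<close>.\<close>

definition dmon :: "(nat \<Rightarrow> mpoly) \<Rightarrow> (nat \<Rightarrow>\<^sub>0 nat) \<Rightarrow> mpoly" where
  "dmon d m = (\<Sum>i\<in>keys m. of_nat (lookup m i) * single (m - single i 1) 1 * d i)"

definition der :: "(nat \<Rightarrow> mpoly) \<Rightarrow> mpoly \<Rightarrow> mpoly" where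
  "der d p = (\<Sum>m\<in>keys p. single 0 (lookup p m) * dmon d m)"

lemma der_add: "der d (p + r) = der d p + der d r"
  unfolding der_def by (rule setsum_keys_plus_distrib) (simp_all add: single_add algebra_simps)

lemma der_0 [simp]: "der d 0 = 0"
  by (simp add: der_def)

lemma der_sum: "der d (\<Sum>x\<in>S. f x) = (\<Sum>x\<in>S. der d (f x))"
  by (induction S rule: infinite_finite_induct) (simp_all add: der_add)

lemma der_single: "der d (single m c) = single 0 c * dmon d m"
  by (auto simp: der_def)

text \<open>The Leibniz rule on monomials. Both index sets are enlarged to \<open>K\<close>, which
  is harmless since absent variables carry the factor 0.\<close>

lemma dmon_add: "dmon d (m + m') = dmon d m * single m' 1 + single m 1 * dmon d m'"
proof -
  define K where "K = keys m \<union> keys m'"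
  have ext: "dmon d u = (\<Sum>i\<in>K. of_nat (lookup u i) * single (u - single i 1) 1 * d i)"
    if "keys u \<subseteq> K" for u
    unfolding dmon_def by (rule sum.mono_neutral_left) (use that in \<open>auto simp: K_def in_keys_iff\<close>)
  \<comment> \<open>Subtraction of exponents is truncated, so \<open>v\<close> can be pulled out
    only if \<open>i\<close> occurs in \<open>u\<close>; otherwise the factor
    \<open>lookup u i\<close> makes both sides 0.\<close>
  have shift: "of_nat (lookup u i) * single (u + v - single i 1) 1
      = of_nat (lookup u i) * single (u - single i 1) 1 * (single v 1 :: mpoly)" for u v i
  proof (cases "lookup u i = 0")
    case False
    have "u + v - single i 1 = (u - single i 1) + v"
      using False by (intro poly_mapping_eqI) (auto simp: lookup_add lookup_minus lookup_single when_def)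
    thus ?thesis by (simp add: mult_single mult.assoc)
  qed auto
  have "dmon d (m + m') = (\<Sum>i\<in>K. of_nat (lookup (m + m') i) * single (m + m' - single i 1) 1 * d i)"
    by (rule ext) (simp add: K_def keys_add_nat)
  also have "\<dots> = (\<Sum>i\<in>K. of_nat (lookup m i) * single (m + m' - single i 1) 1 * d i
      + of_nat (lookup m' i) * single (m' + m - single i 1) 1 * d i)"
    by (simp add: lookup_add algebra_simps)
  also have "\<dots> = (\<Sum>i\<in>K. (of_nat (lookup m i) * single (m - single i 1) 1 * d i) * single m' 1
      + single m 1 * (of_nat (lookup m' i) * single (m' - single i 1) 1 * d i))"
    unfolding shift by (simp add: algebra_simps)
  also have "\<dots> = dmon d m * single m' 1 + single m 1 * dmon d m'"
    using ext[of m] ext[of m'] by (simp add: K_def sum.distrib sum_distrib_left sum_distrib_right)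
  finally show ?thesis .
qed

lemma der_mult: "der d (p * r) = der d p * r + p * der d r"
proof -
  have mon: "der d (single m a * single m' b)
      = der d (single m a) * single m' b + single m a * der d (single m' b)" for m m' a b
  proof -
    have *: "single m a = single 0 a * single m (1::rat)" for m a by (simp add: mult_single)
    have "der d (single m a * single m' b) = (single 0 a * single 0 b) * dmon d (m + m')"
      by (simp add: mult_single der_single)
    thus ?thesis
      unfolding dmon_add der_single by (subst (4 5) *) (simp add: algebra_simps *[of m a] *[of m' b])
  qed
  let ?P = "\<lambda>m. single 0 (lookup p m) * single m (1::rat)"
  let ?R = "\<lambda>m. single 0 (lookup r m) * single m (1::rat)"
  have "der d (p * r) = der d ((\<Sum>m\<in>keys p. ?P m) * (\<Sum>m\<in>keys r. ?R m))"
    by (simp only: monomial_sum[symmetric])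
  also have "\<dots> = (\<Sum>m\<in>keys p. \<Sum>m'\<in>keys r. der d (?P m) * ?R m' + ?P m * der d (?R m'))"
    by (simp add: sum_product der_sum mult_single mon[unfolded mult_single])
  also have "\<dots> = der d (\<Sum>m\<in>keys p. ?P m) * (\<Sum>m\<in>keys r. ?R m)
                 + (\<Sum>m\<in>keys p. ?P m) * der d (\<Sum>m\<in>keys r. ?R m)"
    by (simp add: sum.distrib sum_product der_sum)
  also have "\<dots> = der d p * r + p * der d r"
    by (simp only: monomial_sum[symmetric])
  finally show ?thesis .
qed

lemma der_X: "der d (X i) = d i"
  by (simp add: X_def der_single dmon_def)

lemma der_const: "der d (single 0 c) = 0"
  by (simp add: der_single dmon_def)

lemma der_of_nat: "der d (of_nat c) = 0"
  using der_const[of d "of_nat c"] by simp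

lemma der_cmult: "der d (single 0 c * p) = single 0 c * der d p"
  by (simp add: der_mult der_const)

lemma der_of_nat_mult: "der d (of_nat c * p) = of_nat c * der d p"
  by (simp add: der_mult der_of_nat)

lemma der_uminus: "der d (- p) = - der d p"
  using der_add[of d p "- p"] by (simp add: eq_neg_iff_add_eq_0 add.commute)

text \<open>The hypothesis concerns the product rather than \<open>d i\<close> alone, so that the
  boundary variables, which \<open>Dn\<close> or \<open>Up\<close> sends to 0, fit in as
  well.\<close>

lemma der_hom:
  assumes p: "hom N k w p"
    and d: "\<And>m i. m \<in> mons N k w \<Longrightarrow> i \<in> keys m
      \<Longrightarrow> hom N k' w' (single (m - single i 1) 1 * d i)"
  shows "hom N k' w' (der d p)"
  unfolding der_def dmon_def sum_distrib_left
proof (intro hom_sum)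
  fix m i assume "m \<in> keys p" "i \<in> keys m"
  hence "hom N k' w' (single (m - single i 1) 1 * d i)" using p d by blast
  from hom_mult[OF hom_const[where c = "lookup p m"] hom_mult[OF hom_of_nat[where c = "lookup m i"] this]]
  show "hom N k' w' (single 0 (lookup p m) * (of_nat (lookup m i) * single (m - single i 1) 1 * d i))"
    by (simp add: mult.assoc)
qed

subsection \<open>The action of sl(2) on polynomials\<close>

text \<open>The truncated index at \<open>i = 0\<close> does no harm, as the factor
  \<open>of_nat i\<close> is 0 there. Likewise the factor \<open>N - i\<close> in \<open>Up\<close>
  keeps \<open>X (N + 1)\<close> from appearing.\<close>

definition Dn :: "mpoly \<Rightarrow> mpoly" where
  "Dn = der (\<lambda>i. of_nat i * X (i - 1))"

definition Up :: "nat \<Rightarrow> mpoly \<Rightarrow> mpoly" where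
  "Up N = der (\<lambda>i. of_nat (N - i) * X (i + 1))"

lemma mons_minus_single:
  assumes "m \<in> mons N k w" "i \<in> keys m"
  shows "k \<ge> 1" "w \<ge> i" "i \<le> N" "m - single i 1 \<in> mons N (k - 1) (w - i)"
proof -
  have m: "m = (m - single i 1) + single i 1" using minus_single_add[OF assms(2)] by simp
  have "wsum f m = wsum f (m - single i 1) + f i" for f
    by (subst m) (simp add: wsum_add)
  moreover have "keys (m - single i 1) \<subseteq> keys m"
    by (auto simp: in_keys_iff lookup_minus)
  ultimately show "k \<ge> 1" "w \<ge> i" "i \<le> N" "m - single i 1 \<in> mons N (k - 1) (w - i)"
    using assms by (auto simp: mons_def)
qed

lemma Dn_hom:
  assumes "hom N k (Suc w) p"
  shows "hom N k w (Dn p)"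
  unfolding Dn_def
proof (rule der_hom[OF assms])
  fix m i assume m: "m \<in> mons N k (Suc w)" "i \<in> keys m"
  note b = mons_minus_single[OF m]
  show "hom N k w (single (m - single i 1) 1 * (of_nat i * X (i - 1)))"
  proof (cases "i = 0")
    case False
    have "hom N (k - 1) (Suc w - i) (single (m - single i 1) 1)" using b by simp
    moreover have "hom N (0 + 1) (0 + (i - 1)) (of_nat i * X (i - 1))"
      by (intro hom_mult hom_of_nat hom_X) (use b in auto)
    ultimately have "hom N (k - 1 + (0 + 1)) (Suc w - i + (0 + (i - 1))) (single (m - single i 1) 1 * (of_nat i * X (i - 1)))"
      by (rule hom_mult)
    thus ?thesis using b False by simp
  qed auto
qed

lemma Dn_weight_0:
  assumes "hom N k 0 p"
  shows "Dn p = 0"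
proof -
  have "dmon (\<lambda>i. of_nat i * X (i - 1)) m = 0" if "m \<in> keys p" for m
    unfolding dmon_def
  proof (rule sum.neutral, rule ballI)
    fix i assume "i \<in> keys m"
    with that assms have "i \<le> 0" using mons_minus_single(2) by blast
    thus "of_nat (lookup m i) * single (m - single i 1) 1 * (of_nat i * X (i - 1)) = 0" by simp
  qed
  thus ?thesis by (simp add: Dn_def der_def)
qed

lemma Up_hom:
  assumes "hom N k w p"
  shows "hom N k (Suc w) (Up N p)"
  unfolding Up_def
proof (rule der_hom[OF assms])
  fix m i assume m: "m \<in> mons N k w" "i \<in> keys m"
  note b = mons_minus_single[OF m]
  show "hom N k (Suc w) (single (m - single i 1) 1 * (of_nat (N - i) * X (i + 1)))"
  proof (cases "i = N")
    case False
    have "hom N (k - 1) (w - i) (single (m - single i 1) 1)" using b by simp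
    moreover have "hom N (0 + 1) (0 + (i + 1)) (of_nat (N - i) * X (i + 1))"
      by (intro hom_mult hom_of_nat hom_X) (use b False in auto)
    ultimately have "hom N (k - 1 + (0 + 1)) (w - i + (0 + (i + 1))) (single (m - single i 1) 1 * (of_nat (N - i) * X (i + 1)))"
      by (rule hom_mult)
    thus ?thesis using b by simp
  qed auto
qed

text \<open>The commutator of two derivations obeys the Leibniz rule, so its eigenvalues add over
  the factors of a monomial. On \<open>X i\<close> the eigenvalue is (N - i)(i + 1) - i(N - i + 1) =
  N - 2i. It may be negative, hence the difference of two \<open>of_nat\<close> terms.\<close>

lemma commutator_monomial:
  assumes "keys m \<subseteq> {..N}"
  shows "Dn (Up N (single m 1)) - Up N (Dn (single m 1))
    = (of_nat (N * mdeg m) - of_nat (2 * weight m)) * single m 1"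
  using assms
proof (induction "mdeg m" arbitrary: m)
  case 0
  hence "m = 0" using mdeg_eq_0_iff by metis
  moreover have "der d 1 = 0" for d using der_of_nat[of d 1] by simp
  ultimately show ?case by (simp add: Dn_def Up_def)
next
  case (Suc k)
  have "keys m \<noteq> {}" using Suc.hyps(2) by (auto simp: wsum_def)
  then obtain i where i: "i \<in> keys m" by blast
  define m' where "m' = m - single i 1"
  have m: "m = m' + single i 1" using minus_single_add[OF i] by (simp add: m'_def)
  have iN: "i \<le> N" using i Suc.prems by auto
  let ?p = "single m' 1 :: mpoly"
  have sm: "single m 1 = ?p * X i" by (simp add: m X_def mult_single)
  have IH: "Dn (Up N ?p) - Up N (Dn ?p) = (of_nat (N * mdeg m') - of_nat (2 * weight m')) * ?p"
    using Suc.hyps Suc.prems by (intro Suc.hyps) (auto simp: m wsum_add keys_add_nat)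
  have xi: "Dn (Up N (X i)) - Up N (Dn (X i)) = (of_nat N - of_nat (2 * i)) * X i"
  proof -
    have 1: "Dn (Up N (X i)) = of_nat ((N - i) * (i + 1)) * X i"
      by (simp add: Dn_def Up_def der_X der_of_nat_mult) (simp add: distrib_left)
    have 2: "Up N (Dn (X i)) = of_nat (i * (N - (i - 1))) * X i"
    proof -
      have "Up N (Dn (X i)) = of_nat i * (of_nat (N - (i - 1)) * X (i - 1 + 1))"
        by (simp only: Dn_def Up_def der_X der_of_nat_mult)
      thus ?thesis by (cases i) (simp_all add: distrib_right mult.assoc)
    qed
    have "(of_nat ((N - i) * (i + 1)) - of_nat (i * (N - (i - 1))) :: mpoly)
        = of_nat N - of_nat (2 * i)"
    proof (cases i)
      case (Suc j)
      obtain e where e: "N = i + e" using iN le_Suc_ex by blast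
      show ?thesis unfolding Suc e by (simp add: algebra_simps)
    qed simp
    thus ?thesis unfolding 1 2 by (metis left_diff_distrib)
  qed
  have "Dn (Up N (?p * X i)) - Up N (Dn (?p * X i))
      = (Dn (Up N ?p) - Up N (Dn ?p)) * X i + ?p * (Dn (Up N (X i)) - Up N (Dn (X i)))"
    by (simp add: Dn_def Up_def der_mult der_add algebra_simps)
  also have "\<dots> = (of_nat (N * mdeg m) - of_nat (2 * weight m)) * single m 1"
    unfolding IH xi sm by (simp add: m wsum_add algebra_simps)
  finally show ?case by (simp add: sm)
qed

lemma commutator:
  assumes "hom N k w p"
  shows "Dn (Up N p) = Up N (Dn p) + (of_nat (N * k) - of_nat (2 * w)) * p"
proof -
  let ?c = "of_nat (N * k) - of_nat (2 * w) :: mpoly"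
  let ?P = "\<lambda>m. single 0 (lookup p m) * single m (1::rat)"
  have "Dn (Up N (?P m)) = Up N (Dn (?P m)) + ?c * ?P m" if "m \<in> keys p" for m
  proof -
    have "m \<in> mons N k w" using that assms by blast
    hence c: "Dn (Up N (single m 1)) = Up N (Dn (single m 1)) + ?c * single m 1"
      using commutator_monomial[of m N] by (simp add: mons_def algebra_simps)
    have l: "Dn (Up N (?P m)) = single 0 (lookup p m) * Dn (Up N (single m 1))"
      "Up N (Dn (?P m)) = single 0 (lookup p m) * Up N (Dn (single m 1))"
      by (simp_all only: Dn_def Up_def der_cmult)
    show ?thesis unfolding l c distrib_left by (simp only: mult.left_commute)
  qed
  hence "Dn (Up N (\<Sum>m\<in>keys p. ?P m)) = Up N (Dn (\<Sum>m\<in>keys p. ?P m)) + ?c * (\<Sum>m\<in>keys p. ?P m)"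
    by (simp only: Dn_def Up_def der_sum sum_distrib_left sum.distrib [symmetric]) (rule sum.cong, auto)
  thus ?thesis by (simp only: monomial_sum[of p, symmetric])
qed

text \<open>Applying \<open>Dn\<close> to an eigenvector of \<open>Up Dn\<close> with negative eigenvalue gives another one, of
  smaller weight and with a still more negative eigenvalue; at weight 0 there is none.\<close>

lemma Up_Dn_eigen:
  assumes "hom N k w a" "2 * w \<le> N * k + 2" "c > 0" "Up N (Dn a) = - (of_nat c * a)"
  shows "a = 0"
  using assms
proof (induction w arbitrary: a c)
  case 0
  hence "of_nat c * a = 0" using Dn_weight_0[OF 0(1)] by (simp add: Up_def)
  thus ?case using 0 by simp
next
  case (Suc w)
  let ?a = "Dn a"
  have h: "hom N k w ?a" using Suc.prems by (intro Dn_hom)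
  have 1: "Dn (Up N ?a) = - (of_nat c * ?a)"
    unfolding Suc.prems(4) by (simp only: Dn_def der_uminus der_of_nat_mult)
  have "Up N (Dn ?a) = Dn (Up N ?a) - (of_nat (N * k) - of_nat (2 * w)) * ?a"
    by (simp only: commutator[OF h] add_diff_cancel_right')
  also have "\<dots> = - ((of_nat c + (of_nat (N * k) - of_nat (2 * w))) * ?a)"
    unfolding 1 by (simp only: distrib_right minus_add_distrib diff_conv_add_uminus)
  \<comment> \<open>The weight bound for \<open>Suc w\<close> gives
    \<open>2 * w \<le> N * k\<close>, so the natural subtraction is exact and the new constant is
    still positive.\<close>
  also have "of_nat c + (of_nat (N * k) - of_nat (2 * w)) = (of_nat (c + (N * k - 2 * w)) :: mpoly)"
    using Suc.prems(2) by (simp add: of_nat_diff)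
  finally have "?a = 0"
    using Suc.prems by (intro Suc.IH[OF h, of "c + (N * k - 2 * w)"]) auto
  thus ?case using Suc.prems(3,4) by (simp add: Up_def)
qed

text \<open>By the commutator relation, \<open>Dn (Up N a) = 0\<close> makes \<open>a\<close> an
  eigenvector of Up Dn with eigenvalue -(N k - 2 w), which is negative below the middle
  weight.\<close>

lemma Dn_Up_inj:
  assumes "hom N k w a" "2 * w < N * k" "Dn (Up N a) = 0"
  shows "a = 0"
proof (rule Up_Dn_eigen[OF assms(1)])
  have "Up N (Dn a) = - ((of_nat (N * k) - of_nat (2 * w)) * a)"
    using commutator[OF assms(1)] assms(3) by (metis eq_neg_iff_add_eq_0)
  thus "Up N (Dn a) = - (of_nat (N * k - 2 * w) * a)"
    using assms(2) by (simp add: of_nat_diff)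
qed (use assms in auto)

section \<open>Linear dependence by counting: Gaussian elimination\<close>

lemma homogeneous_system_nontrivial:
  fixes M :: "'s \<Rightarrow> 't \<Rightarrow> 'a::field"
  assumes "finite T" "finite S" "card T < card S"
  shows "\<exists>x. (\<exists>s\<in>S. x s \<noteq> 0) \<and> (\<forall>t\<in>T. (\<Sum>s\<in>S. x s * M s t) = 0)"
  using assms
proof (induction T arbitrary: S M rule: finite_induct)
  case empty
  hence "S \<noteq> {}" by auto
  thus ?case by (intro exI[of _ "\<lambda>_. 1"]) auto
next
  case (insert t T)
  show ?case
  proof (cases "\<forall>s\<in>S. M s t = 0")
    case True
    from insert.prems insert.hyps have "card T < card S" by auto
    from insert.IH[OF insert.prems(1) this, of M] True show ?thesis by auto
  next
    case False
    then obtain r where r: "r \<in> S" "M r t \<noteq> 0" by blast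
    \<comment> \<open>Row \<open>r\<close> is the pivot for equation \<open>t\<close>: subtracting
      multiples of it clears column \<open>t\<close>, leaving one unknown and one equation
      fewer.\<close>
    define M' where "M' s u = M s u - M s t / M r t * M r u" for s u
    have "card T < card (S - {r})" using insert r by auto
    with insert.IH[of "S - {r}" M'] insert.prems(1)
    obtain x where x: "\<exists>s\<in>S - {r}. x s \<noteq> 0" "\<forall>u\<in>T. (\<Sum>s\<in>S - {r}. x s * M' s u) = 0"
      by blast
    \<comment> \<open>The value of the pivot unknown that equation \<open>t\<close> forces.\<close>
    define c where "c = - (\<Sum>s\<in>S - {r}. x s * M s t) / M r t"
    have "(\<Sum>s\<in>S. (x(r := c)) s * M s u) = (\<Sum>s\<in>S - {r}. x s * M' s u)" for u
    proof -
      have "(\<Sum>s\<in>S. (x(r := c)) s * M s u) = c * M r u + (\<Sum>s\<in>S - {r}. x s * M s u)"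
        using insert.prems(1) r by (auto simp: sum.remove intro!: sum.cong)
      also have "\<dots> = (\<Sum>s\<in>S - {r}. x s * M' s u)"
        by (simp add: M'_def c_def right_diff_distrib sum_subtractf sum_distrib_right
            sum_divide_distrib mult.assoc)
      finally show ?thesis .
    qed
    moreover have "M' s t = 0" for s using r by (simp add: M'_def)
    ultimately have "\<forall>u\<in>insert t T. (\<Sum>s\<in>S. (x(r := c)) s * M s u) = 0"
      using x(2) by simp
    moreover have "\<exists>s\<in>S. (x(r := c)) s \<noteq> 0" using x(1) by auto
    ultimately show ?thesis by blast
  qed
qed

text \<open>A dimension count: polynomials supported on \<open>T\<close> have coefficient vectors of
  length \<open>card T\<close>, so more than that many are dependent.\<close>

lemma linear_relation:
  fixes \<phi> :: "'s \<Rightarrow> mpoly"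
  assumes "finite T" "finite S" "card T < card S" "\<And>s. s \<in> S \<Longrightarrow> keys (\<phi> s) \<subseteq> T"
  shows "\<exists>x. (\<exists>s\<in>S. x s \<noteq> 0) \<and> (\<Sum>s\<in>S. single 0 (x s) * \<phi> s) = 0"
proof -
  obtain x where x: "\<exists>s\<in>S. x s \<noteq> 0" "\<forall>t\<in>T. (\<Sum>s\<in>S. x s * lookup (\<phi> s) t) = 0"
    using homogeneous_system_nontrivial[OF assms(1-3), of "\<lambda>s. lookup (\<phi> s)"] by blast
  have scale: "lookup (single 0 c * p) t = c * lookup p t" for c p and t :: "nat \<Rightarrow>\<^sub>0 nat"
    by (cases "lookup p t = 0")
       (simp_all add: mult_map_scale_conv_mult[symmetric] Poly_Mapping.map.rep_eq)
  have "(\<Sum>s\<in>S. x s * lookup (\<phi> s) t) = 0" for t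
  proof (cases "t \<in> T")
    case False
    hence "lookup (\<phi> s) t = 0" if "s \<in> S" for s using assms(4)[OF that] by (auto simp: in_keys_iff)
    thus ?thesis by simp
  qed (use x in auto)
  hence "(\<Sum>s\<in>S. single 0 (x s) * \<phi> s) = 0"
    by (intro poly_mapping_eqI) (simp add: lookup_sum scale)
  thus ?thesis using x(1) by blast
qed

subsection \<open>The invariant quadratic form and the growth of the weight spaces\<close>

text \<open>The classical quadratic invariant of a binary form of degree \<open>N\<close>, up to
  scaling the form's transvectant with itself of order \<open>N\<close>.\<close>

definition quadric :: "nat \<Rightarrow> mpoly" where
  "quadric N = (\<Sum>i\<le>N. single 0 ((-1) ^ i * of_nat (N choose i)) * (X i * X (N - i)))"

lemma hom_quadric: "hom N 2 N (quadric N)"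
  unfolding quadric_def
proof (rule hom_sum)
  fix i assume "i \<in> {..N}"
  hence "hom N (0 + (1 + 1)) (0 + (i + (N - i)))
      (single 0 ((-1) ^ i * of_nat (N choose i)) * (X i * X (N - i)))"
    by (intro hom_mult hom_const hom_X) auto
  thus "hom N 2 N (single 0 ((-1) ^ i * of_nat (N choose i)) * (X i * X (N - i)))"
    using \<open>i \<in> {..N}\<close> by (simp add: numeral_2_eq_2)
qed

text \<open>After an index shift both halves of the Leibniz rule run over
  \<open>X i * X (N - i - 1)\<close>. They cancel by the alternating sign and (i + 1) binom(N, i +
  1) = (N - i) binom(N, i).\<close>

lemma Dn_quadric: "Dn (quadric N) = 0"
proof -
  let ?c = "\<lambda>i. (-1) ^ i * of_nat (N choose i) :: rat"
  have "Dn (quadric N) = (\<Sum>i\<le>N. single 0 (?c i * of_nat i) * (X (i - 1) * X (N - i)))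
      + (\<Sum>i\<le>N. single 0 (?c i * of_nat (N - i)) * (X i * X (N - i - 1)))"
  proof -
    have split: "single 0 (c * of_nat j) = single 0 c * (of_nat j :: mpoly)" for c j
      by (simp flip: single_of_nat add: mult_single)
    show ?thesis
      unfolding quadric_def Dn_def der_sum der_cmult der_mult[of _ "X _"] der_X sum.distrib[symmetric]
      by (simp only: split distrib_left) (simp only: mult_ac)
  qed
  also have "(\<Sum>i\<le>N. single 0 (?c i * of_nat i) * (X (i - 1) * X (N - i)))
      = (\<Sum>i<N. single 0 (?c (Suc i) * of_nat (Suc i)) * (X i * X (N - i - 1)))"
    unfolding sum.atMost_shift by simp
  also have "(\<Sum>i\<le>N. single 0 (?c i * of_nat (N - i)) * (X i * X (N - i - 1)))
      = (\<Sum>i<N. single 0 (?c i * of_nat (N - i)) * (X i * X (N - i - 1)))"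
    by (simp add: lessThan_Suc_atMost[symmetric])
  also have "(\<Sum>i<N. single 0 (?c (Suc i) * of_nat (Suc i)) * (X i * X (N - i - 1))) + \<dots> = 0"
  proof -
    have "?c (Suc i) * of_nat (Suc i) + ?c i * of_nat (N - i) = 0" for i
    proof -
      have "Suc i * (N choose Suc i) = (N - i) * (N choose i)"
        by (simp only: binomial_absorption binomial_absorb_comp)
      hence "of_nat (Suc i) * of_nat (N choose Suc i) = (of_nat (N - i) * of_nat (N choose i) :: rat)"
        by (simp only: of_nat_mult[symmetric])
      thus ?thesis by (simp only: power_Suc) (simp only: mult.commute mult.left_commute; simp)
    qed
    thus ?thesis
      by (simp only: sum.distrib[symmetric] distrib_right[symmetric] single_add[symmetric]) simp
  qed
  finally show ?thesis .
qed

text \<open>Only the middle summand contributes to the square of the middle variable. For odd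
  \<open>N\<close> the summands \<open>i\<close> and \<open>N - i\<close> would cancel.\<close>

lemma quadric_neq_0:
  assumes "even N"
  shows "quadric N \<noteq> 0"
proof -
  obtain h where N: "N = 2 * h" using assms by blast
  have "lookup (single 0 c * (X i * X (N - i))) (single h 2) = (if i = h then c else 0)"
    if "i \<le> N" for i c
  proof (cases "i = h")
    case False
    hence "lookup (single i 1 + single (N - i) 1) h \<noteq> lookup (single h (2::nat)) h"
      using that by (auto simp: lookup_add lookup_single when_def N)
    hence "single i 1 + single (N - i) 1 \<noteq> single h (2::nat)" by metis
    thus ?thesis using False by (simp add: X_def mult_single lookup_single)
  qed (simp add: N X_def mult_single lookup_single single_add[symmetric] numeral_2_eq_2)
  hence "lookup (quadric N) (single h 2) = (-1) ^ h * of_nat (N choose h)"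
    by (simp add: quadric_def lookup_sum N)
  moreover have "\<dots> \<noteq> (0::rat)" by (simp add: N)
  ultimately show ?thesis by (metis lookup_zero)
qed

section \<open>Dimension count for weight spaces modulo the quadric\<close>

lemma finite_mons: "finite (mons N k w)"
proof -
  have "mons N k w \<subseteq> lookup -` {f. \<forall>i. (i \<in> {..N} \<longrightarrow> f i \<in> {..k}) \<and> (i \<notin> {..N} \<longrightarrow> f i = 0)}"
  proof
    fix m assume m: "m \<in> mons N k w"
    have "lookup m i \<le> k" for i
    proof (cases "i \<in> keys m")
      case True
      hence "lookup m i \<le> mdeg m" by (simp add: wsum_def member_le_sum)
      thus ?thesis using m by (simp add: mons_def)
    qed (simp add: in_keys_iff)
    thus "m \<in> lookup -` {f. \<forall>i. (i \<in> {..N} \<longrightarrow> f i \<in> {..k}) \<and> (i \<notin> {..N} \<longrightarrow> f i = 0)}"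
      using m by (auto simp: mons_def in_keys_iff)
  qed
  moreover have "finite \<dots>"
    by (intro finite_vimageI finite_set_of_finite_funs) (auto intro: injI poly_mapping_eqI)
  ultimately show ?thesis by (rule finite_subset)
qed

text \<open>Indexes the multiples of \<open>quadric N\<close> of weight \<open>w\<close> by their
  cofactors. The case split keeps a truncated \<open>w - N\<close> from counting weight 0.\<close>

definition shifted_mons :: "nat \<Rightarrow> nat \<Rightarrow> nat \<Rightarrow> (nat \<Rightarrow>\<^sub>0 nat) set" where
  "shifted_mons N k w = (if N \<le> w then mons N k (w - N) else {})"

text \<open>Rearranged to avoid natural subtraction: below the middle weight, the weight spaces of
  the quotient by multiples of \<open>quadric N\<close> do not shrink from \<open>w\<close> to
  \<open>Suc w\<close>. An injective linear map between the corresponding direct sums gives the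
  inequality.\<close>

lemma card_mons_increase:
  assumes "even N" "2 * w < N * (k + 2)"
  shows "card (shifted_mons N k (Suc w)) + card (mons N (k + 2) w)
    \<le> card (mons N (k + 2) (Suc w)) + card (shifted_mons N k w)"
proof (rule ccontr)
  assume less: "\<not> ?thesis"
  let ?B = "shifted_mons N k (Suc w)" and ?A = "mons N (k + 2) w"
  let ?A' = "mons N (k + 2) (Suc w)" and ?B' = "shifted_mons N k w"
  have fin: "finite ?B" "finite ?A" "finite ?A'" "finite ?B'"
    by (simp_all add: shifted_mons_def finite_mons)
  have Dn_B: "keys (Dn b) \<subseteq> ?B'" if b: "keys b \<subseteq> ?B" for b
  proof -
    \<comment> \<open>At \<open>N = Suc w\<close> the cofactor \<open>b\<close> has weight 0, so
      \<open>Dn\<close> kills it, matching the empty \<open>?B'\<close>; for smaller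
      \<open>w\<close> already \<open>?B\<close> is empty.\<close>
    consider "N \<le> w" | "N = Suc w" | "Suc w < N" by linarith
    thus ?thesis
    proof cases
      case 1
      thus ?thesis using b by (simp add: shifted_mons_def Suc_diff_le Dn_hom)
    next
      case 2
      hence "Dn b = 0" using b by (intro Dn_weight_0[of b N k]) (simp add: shifted_mons_def)
      thus ?thesis by simp
    next
      case 3
      hence "b = 0" using b by (auto simp: shifted_mons_def in_keys_iff intro!: poly_mapping_eqI)
      thus ?thesis by (simp add: Dn_def)
    qed
  qed
  have quadric_B: "keys (quadric N * b) \<subseteq> ?A'" if b: "keys b \<subseteq> ?B" for b
  proof (cases "N \<le> Suc w")
    case True
    hence "hom N (2 + k) (N + (Suc w - N)) (quadric N * b)"
      using b by (intro hom_mult hom_quadric) (simp add: shifted_mons_def)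
    thus ?thesis using True by (simp add: add.commute)
  next
    case False
    hence "b = 0" using b by (auto simp: shifted_mons_def in_keys_iff intro!: poly_mapping_eqI)
    thus ?thesis by simp
  qed
  \<comment> \<open>The map \<open>(b, a) \<mapsto> (Q b + Up a, Dn b)\<close> is injective: if it kills \<open>(b, a)\<close>, then
    \<open>Dn (Up a) = - Q (Dn b) = 0\<close>, so \<open>a = 0\<close> and \<open>Q b = 0\<close>.\<close>
  define \<phi> where "\<phi> s = (case s of Inl m \<Rightarrow> quadric N * single m 1 + Dn (single m 1)
    | Inr m \<Rightarrow> Up N (single m 1))" for s
  have "\<exists>x. (\<exists>s\<in>?B <+> ?A. x s \<noteq> 0) \<and> (\<Sum>s\<in>?B <+> ?A. single 0 (x s) * \<phi> s) = 0"
  proof (rule linear_relation[where T = "?A' \<union> ?B'"])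
    show "card (?A' \<union> ?B') < card (?B <+> ?A)"
      using less fin card_Un_le[of ?A' ?B'] by (simp add: card_Plus)
  next
    fix s assume "s \<in> ?B <+> ?A"
    then consider m where "s = Inl m" "m \<in> ?B" | m where "s = Inr m" "m \<in> ?A" by blast
    thus "keys (\<phi> s) \<subseteq> ?A' \<union> ?B'"
    proof cases
      case 1
      have "keys (quadric N * single m 1) \<subseteq> ?A'" "keys (Dn (single m 1)) \<subseteq> ?B'"
        using 1 by (intro quadric_B Dn_B; simp)+
      thus ?thesis using keys_add unfolding \<phi>_def 1 by fastforce
    next
      case 2
      have "hom N (k + 2) (Suc w) (Up N (single m 1))" using 2 by (intro Up_hom) simp
      thus ?thesis using 2 by (auto simp: \<phi>_def)
    qed
  qed (use fin in auto)
  then obtain x where x: "\<exists>s\<in>?B <+> ?A. x s \<noteq> 0" "(\<Sum>s\<in>?B <+> ?A. single 0 (x s) * \<phi> s) = 0"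
    by blast
  define b where "b = (\<Sum>m\<in>?B. single 0 (x (Inl m)) * single m (1::rat))"
  define a where "a = (\<Sum>m\<in>?A. single 0 (x (Inr m)) * single m (1::rat))"
  have lb: "lookup b m = (if m \<in> ?B then x (Inl m) else 0)" for m
    using fin by (simp add: b_def mult_single lookup_sum lookup_single when_def)
  have la: "lookup a m = (if m \<in> ?A then x (Inr m) else 0)" for m
    using fin by (simp add: a_def mult_single lookup_sum lookup_single when_def)
  have hb: "keys b \<subseteq> ?B" and ha: "keys a \<subseteq> ?A" by (auto simp: in_keys_iff lb la split: if_splits)
  have "(\<Sum>s\<in>?B <+> ?A. single 0 (x s) * \<phi> s)
      = (\<Sum>m\<in>?B. single 0 (x (Inl m)) * \<phi> (Inl m)) + (\<Sum>m\<in>?A. single 0 (x (Inr m)) * \<phi> (Inr m))"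
    using fin by (simp add: sum.Plus)
  also have "\<dots> = (quadric N * b + Dn b) + Up N a"
    unfolding a_def b_def \<phi>_def Dn_def Up_def der_sum der_cmult
    by (simp only: sum.case distrib_left sum.distrib sum_distrib_left mult.left_commute)
  finally have rel: "Dn b + (quadric N * b + Up N a) = 0" using x(2) by (simp add: algebra_simps)
  have "hom N (k + 2) (Suc w) (Up N a)" using ha by (rule Up_hom)
  hence k1: "keys (quadric N * b + Up N a) \<subseteq> ?A'" using quadric_B[OF hb] by (intro hom_add)
  \<comment> \<open>The pair of images was encoded as one sum; the components have degrees
    \<open>k + 2\<close> and \<open>k\<close>, so each must vanish separately.\<close>
  have "?A' \<inter> ?B' = {}" by (auto simp: shifted_mons_def mons_def)
  moreover have "keys (Dn b) \<subseteq> keys (quadric N * b + Up N a)"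
    using rel by (auto simp: in_keys_iff poly_mapping_eq_iff lookup_add fun_eq_iff add_eq_0_iff)
  ultimately have "keys (Dn b) = {}" using k1 Dn_B[OF hb] by blast
  hence Db: "Dn b = 0" by (auto simp: in_keys_iff intro!: poly_mapping_eqI)
  have qU: "Up N a = - (quadric N * b)" using rel Db by (simp add: add_eq_0_iff)
  have "Dn (Up N a) = 0"
    unfolding qU using Db Dn_quadric[of N] by (simp add: Dn_def der_uminus der_mult)
  hence "a = 0" using Dn_Up_inj[OF ha assms(2)] by simp
  hence "quadric N * b = 0" using qU by (simp add: Up_def)
  hence "b = 0" using quadric_neq_0[OF assms(1)] by simp
  have "x (Inl m) = 0" if "m \<in> ?B" for m using lb[of m] that \<open>b = 0\<close> by simp
  moreover have "x (Inr m) = 0" if "m \<in> ?A" for m using la[of m] that \<open>a = 0\<close> by simp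
  ultimately show False using x(1) by blast
qed

subsection \<open>Gaussian polynomials count monomials by weight\<close>

definition all_mons :: "nat \<Rightarrow> nat \<Rightarrow> (nat \<Rightarrow>\<^sub>0 nat) set" where
  "all_mons N k = {m. keys m \<subseteq> {..N} \<and> mdeg m = k}"

text \<open>As \<open>X 0\<close> has weight 0, this is the generating function by size of the
  partitions with at most \<open>k\<close> parts, each at most \<open>N\<close>.\<close>

definition gauss_gf :: "nat \<Rightarrow> nat \<Rightarrow> rat poly" where
  "gauss_gf N k = (\<Sum>m\<in>all_mons N k. monom 1 (weight m))"

lemma all_mons_0_deg: "all_mons N 0 = {0}"
  using mdeg_eq_0_iff by (auto simp: all_mons_def)

lemma all_mons_0_vars: "all_mons 0 k = {single 0 k}"
proof -
  have "m = single 0 k" if "keys m \<subseteq> {..0}" "mdeg m = k" for m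
  proof (rule poly_mapping_eqI)
    fix i
    show "lookup m i = lookup (single 0 k) i"
    proof (cases "i = 0")
      case True
      have "mdeg m = (\<Sum>i\<in>{0}. lookup m i)"
        unfolding wsum_def by (rule sum.mono_neutral_cong_left) (use that in \<open>auto simp: in_keys_iff\<close>)
      thus ?thesis using True that by simp
    next
      case False
      hence "i \<notin> keys m" using that by auto
      thus ?thesis using False by (simp add: in_keys_iff lookup_single)
    qed
  qed
  thus ?thesis by (auto simp: all_mons_def split: if_splits)
qed

text \<open>Monomials are split by whether the last variable divides them; this is the combinatorial
  source of the q-Pascal rule \<open>gauss_gf_Suc\<close>.\<close>

lemma all_mons_Suc:
  "all_mons (Suc N) (Suc k) = all_mons N (Suc k) \<union> (\<lambda>m. m + single (Suc N) 1) ` all_mons (Suc N) k"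
  (is "?L = ?R1 \<union> ?R2")
proof (intro equalityI subsetI)
  fix m assume m: "m \<in> ?L"
  show "m \<in> ?R1 \<union> ?R2"
  proof (cases "Suc N \<in> keys m")
    case True
    let ?m = "m - single (Suc N) 1"
    have eq: "?m + single (Suc N) 1 = m" using True by (rule minus_single_add)
    have "mdeg m = mdeg ?m + 1" by (subst eq[symmetric]) (simp add: wsum_add)
    moreover have "keys ?m \<subseteq> keys m" by (auto simp: in_keys_iff lookup_minus)
    ultimately have "?m \<in> all_mons (Suc N) k" using m by (auto simp: all_mons_def)
    thus ?thesis using eq by (metis UnI2 imageI)
  next
    case False
    have "keys m \<subseteq> {..N}"
    proof
      fix i assume "i \<in> keys m"
      hence "i \<le> Suc N" "i \<noteq> Suc N" using m False by (auto simp: all_mons_def)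
      thus "i \<in> {..N}" by simp
    qed
    thus ?thesis using m by (simp add: all_mons_def)
  qed
next
  fix m assume "m \<in> ?R1 \<union> ?R2"
  thus "m \<in> ?L" by (fastforce simp: all_mons_def wsum_add keys_add_nat)
qed

lemma finite_all_mons: "finite (all_mons N k)"
proof (induction "N + k" arbitrary: N k)
  case (Suc n)
  show ?case
  proof (cases N; cases k)
    fix N' k' assume "N = Suc N'" "k = Suc k'"
    thus ?thesis using Suc by (simp add: all_mons_Suc)
  qed (simp_all add: all_mons_0_deg all_mons_0_vars)
qed (simp add: all_mons_0_deg)

lemma coeff_gauss_gf: "coeff (gauss_gf N k) w = of_nat (card (mons N k w))"
proof -
  have "coeff (gauss_gf N k) w = (\<Sum>m\<in>all_mons N k. if weight m = w then 1 else 0)"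
    by (simp add: gauss_gf_def coeff_sum)
  also have "\<dots> = of_nat (card {m \<in> all_mons N k. weight m = w})"
    using finite_all_mons by (simp add: sum.If_cases Int_def)
  also have "{m \<in> all_mons N k. weight m = w} = mons N k w"
    by (auto simp: all_mons_def mons_def)
  finally show ?thesis .
qed

lemma gauss_gf_Suc:
  "gauss_gf (Suc N) (Suc k) = gauss_gf N (Suc k) + qX ^ Suc N * gauss_gf (Suc N) k"
proof -
  have "all_mons N (Suc k) \<inter> (\<lambda>m. m + single (Suc N) 1) ` all_mons (Suc N) k = {}"
    by (auto simp: all_mons_def keys_add_nat)
  moreover have "inj_on (\<lambda>m. m + single (Suc N) (1::nat)) A" for A by (simp add: inj_on_def)
  ultimately show ?thesis
    unfolding gauss_gf_def all_mons_Suc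
    by (simp add: sum.union_disjoint finite_all_mons sum.reindex wsum_add sum_distrib_left
        monom_altdef power_add mult_ac)
qed

section \<open>The product formula, through the q-Pochhammer symbols (q; q)_n\<close>

definition qfact :: "nat \<Rightarrow> rat poly" where
  "qfact n = (\<Prod>i<n. 1 - qX ^ Suc i)"

lemma qfact_Suc: "qfact (Suc n) = qfact n * (1 - qX ^ Suc n)"
  by (simp add: qfact_def)

lemma one_minus_qX_power_neq_0: "n > 0 \<Longrightarrow> 1 - qX ^ n \<noteq> 0"
proof
  assume "n > 0" "1 - qX ^ n = 0"
  hence "poly (1 - qX ^ n) 0 = 0" by simp
  thus False using \<open>n > 0\<close> by (simp add: zero_power)
qed

lemma qfact_neq_0: "qfact n \<noteq> 0"
  unfolding qfact_def prod_zero_iff[OF finite_lessThan] using one_minus_qX_power_neq_0 by blast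

text \<open>Stated without division. The induction uses the q-Pascal rule and (1 - q^N) + q^N (1 -
  q^k) = 1 - q^(N + k).\<close>

lemma gauss_gf_qfact: "gauss_gf N k * (qfact k * qfact N) = qfact (N + k)"
proof (induction "N + k" arbitrary: N k)
  case 0
  thus ?case by (simp add: gauss_gf_def all_mons_0_deg qfact_def monom_0)
next
  case (Suc n)
  show ?case
  proof (cases N; cases k)
    fix N' k' assume Nk: "N = Suc N'" "k = Suc k'"
    have 1: "gauss_gf N' (Suc k') * (qfact (Suc k') * qfact N') = qfact (N' + Suc k')"
      using Suc Nk by simp
    have 2: "gauss_gf (Suc N') k' * (qfact k' * qfact (Suc N')) = qfact (Suc N' + k')"
      using Suc Nk by simp
    have "gauss_gf N k * (qfact k * qfact N)
        = gauss_gf N' (Suc k') * (qfact (Suc k') * qfact N') * (1 - qX ^ Suc N')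
        + qX ^ Suc N' * (gauss_gf (Suc N') k' * (qfact k' * qfact (Suc N'))) * (1 - qX ^ Suc k')"
      unfolding Nk gauss_gf_Suc
      by (simp only: distrib_right) (simp only: qfact_Suc mult_ac)
    also have "\<dots> = qfact (Suc (N' + k')) * (1 - qX ^ (Suc N' + Suc k'))"
      unfolding 1 2 power_add by (simp add: algebra_simps del: power_Suc)
    also have "\<dots> = qfact (N + k)" by (simp add: Nk qfact_Suc)
    finally show ?thesis .
  qed (simp_all add: gauss_gf_def all_mons_0_deg all_mons_0_vars qfact_def monom_0)
qed

text \<open>The product formula exhibits the numerator as \<open>gauss_gf N k\<close> times the
  denominator, so the \<open>div\<close> in \<open>gauss_poly\<close> is exact.\<close>

lemma gauss_poly_eq_gf: "gauss_poly (N + k) k = gauss_gf N k"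
proof -
  have "qfact N * (\<Prod>i<k. 1 - qX ^ (N + k - i)) = qfact (N + k)"
  proof (induction k)
    case (Suc k)
    have "(\<Prod>i<Suc k. 1 - qX ^ (N + Suc k - i)) = (1 - qX ^ (N + Suc k)) * (\<Prod>i<k. 1 - qX ^ (N + k - i))"
      unfolding prod.lessThan_Suc_shift by simp
    thus ?case using Suc.IH by (simp add: qfact_Suc mult_ac)
  qed simp
  hence *: "(\<Prod>i<k. 1 - qX ^ (N + k - i)) = gauss_gf N k * qfact k"
    using gauss_gf_qfact[of N k] qfact_neq_0[of N]
    by (metis mult.commute mult.assoc mult_left_cancel)
  have den: "(\<Prod>i<k. 1 - qX ^ (k - i)) = qfact k"
  proof (induction k)
    case (Suc k)
    thus ?case unfolding prod.lessThan_Suc_shift by (simp add: qfact_Suc mult_ac)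
  qed (simp add: qfact_def)
  show ?thesis unfolding gauss_poly_def * den using qfact_neq_0 by simp
qed

text \<open>The ratio of neighbouring Gaussian polynomials, cross-multiplied.\<close>

lemma gauss_gf_Suc_left:
  "gauss_gf (Suc N) k * (1 - qX ^ Suc N) = gauss_gf N k * (1 - qX ^ Suc (N + k))"
proof -
  have "gauss_gf (Suc N) k * (1 - qX ^ Suc N) * (qfact k * qfact N) = qfact (Suc (N + k))"
    using gauss_gf_qfact[of "Suc N" k] by (simp only: qfact_Suc mult_ac add_Suc)
  also have "\<dots> = gauss_gf N k * (1 - qX ^ Suc (N + k)) * (qfact k * qfact N)"
    unfolding qfact_Suc gauss_gf_qfact[symmetric] by (simp only: mult_ac)
  finally show ?thesis using qfact_neq_0 by simp
qed

lemma gauss_gf_Suc_right: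
  "gauss_gf N (Suc k) * (1 - qX ^ Suc k) = gauss_gf N k * (1 - qX ^ Suc (N + k))"
proof -
  have "gauss_gf N (Suc k) * (1 - qX ^ Suc k) * (qfact k * qfact N) = qfact (Suc (N + k))"
    using gauss_gf_qfact[of N "Suc k"] by (simp only: qfact_Suc mult_ac add_Suc_right)
  also have "\<dots> = gauss_gf N k * (1 - qX ^ Suc (N + k)) * (qfact k * qfact N)"
    unfolding qfact_Suc gauss_gf_qfact[symmetric] by (simp only: mult_ac)
  finally show ?thesis using qfact_neq_0 by simp
qed

subsection \<open>Symmetry and degrees\<close>

lemma coeff_qX_power: "coeff (qX ^ m) i = (if i = m then 1 else 0)"
proof -
  have "qX ^ m = monom 1 m" by (simp add: monom_altdef)
  thus ?thesis by simp
qed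

lemma degree_one_minus_qX_power: "degree (1 - qX ^ m) = m"
proof (cases "m = 0")
  case False
  thus ?thesis by (intro antisym degree_le le_degree) (auto simp: coeff_qX_power coeff_1)
qed simp

lemma reflect_one_minus_qX_power: "m > 0 \<Longrightarrow> reflect_poly (1 - qX ^ m) = - (1 - qX ^ m)"
  by (rule poly_eqI)
     (auto simp: coeff_reflect_poly degree_one_minus_qX_power coeff_qX_power coeff_1)

lemma reflect_qfact: "reflect_poly (qfact n) = (-1) ^ n * qfact n"
proof (induction n)
  case (Suc n)
  show ?case
    unfolding qfact_Suc reflect_poly_mult Suc.IH reflect_one_minus_qX_power[OF zero_less_Suc] power_Suc[of "-1"]
    by (simp only: mult_minus_left mult_minus_right mult_1 mult.assoc)
qed (simp add: qfact_def)

text \<open>Each factor 1 - q^m with m > 0 changes sign under reflection. Both sides of the product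
  formula have \<open>N + k\<close> such factors, so the signs cancel.\<close>

lemma reflect_gauss_gf: "reflect_poly (gauss_gf N k) = gauss_gf N k"
proof -
  have "reflect_poly (gauss_gf N k) * (reflect_poly (qfact k) * reflect_poly (qfact N))
      = reflect_poly (qfact (N + k))"
    by (simp only: reflect_poly_mult[symmetric] gauss_gf_qfact)
  hence "(-1) ^ (N + k) * (reflect_poly (gauss_gf N k) * (qfact k * qfact N))
      = (-1) ^ (N + k) * qfact (N + k)"
    by (simp only: reflect_qfact power_add mult_ac)
  also have "\<dots> = (-1) ^ (N + k) * (gauss_gf N k * (qfact k * qfact N))"
    by (simp only: gauss_gf_qfact)
  finally show ?thesis using qfact_neq_0 by simp
qed

lemma degree_qfact: "2 * degree (qfact n) = n * (n + 1)"
proof (induction n)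
  case (Suc n)
  have "degree (qfact (Suc n)) = degree (qfact n) + Suc n"
    unfolding qfact_Suc
    by (subst degree_mult_eq) (use qfact_neq_0 one_minus_qX_power_neq_0 in \<open>auto simp only: degree_one_minus_qX_power\<close>)
  thus ?case using Suc by simp
qed (simp add: qfact_def)

lemma gauss_gf_neq_0: "gauss_gf N k \<noteq> 0"
  using gauss_gf_qfact[of N k] qfact_neq_0[of "N + k"] by auto

lemma degree_gauss_gf: "degree (gauss_gf N k) = N * k"
proof -
  have "degree (qfact (N + k)) = degree (gauss_gf N k) + (degree (qfact k) + degree (qfact N))"
    unfolding gauss_gf_qfact[symmetric]
    by (simp add: degree_mult_eq gauss_gf_neq_0 qfact_neq_0)
  thus ?thesis using degree_qfact[of "N + k"] degree_qfact[of N] degree_qfact[of k]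
    by (simp add: algebra_simps)
qed

subsection \<open>The q-Catalan polynomial\<close>

text \<open>The division defining \<open>q_catalan\<close> is exact: for n > 0 the quotient is
  [2n, n] - q [2n, n - 1].\<close>

lemma q_catalan_mult: "(1 - qX ^ (n + 1)) * q_catalan n = (1 - qX) * gauss_gf n n"
proof (cases n)
  case 0
  thus ?thesis by (simp add: q_catalan_def gauss_poly_def gauss_gf_def all_mons_0_deg monom_0)
next
  case (Suc k)
  have "gauss_gf (Suc n) k * (1 - qX ^ Suc n) = gauss_gf n n * (1 - qX ^ n)"
    using gauss_gf_Suc_left[of n k] gauss_gf_Suc_right[of n k] Suc by simp
  moreover have "p * (g - x * h) = p * g - x * (h * p)" for p g h x :: "rat poly"
    by (simp add: algebra_simps)
  ultimately have "(1 - qX ^ (n + 1)) * (gauss_gf n n - qX * gauss_gf (Suc n) k)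
      = (1 - qX ^ (n + 1)) * gauss_gf n n - qX * (gauss_gf n n * (1 - qX ^ n))"
    by (simp only: Suc_eq_plus1)
  also have "\<dots> = (1 - qX) * gauss_gf n n"
    by (simp add: algebra_simps)
  finally have "(1 - qX) * gauss_gf n n
      = (1 - qX ^ (n + 1)) * (gauss_gf n n - qX * gauss_gf (Suc n) k)" ..
  moreover have "gauss_poly (2 * n) n = gauss_gf n n"
    using gauss_poly_eq_gf[of n n] by (simp add: mult_2)
  ultimately show ?thesis
    unfolding q_catalan_def by (metis dvd_triv_left dvd_mult_div_cancel)
qed

lemma weighted_q_catalan_mult:
  "((1 - qX ^ (3 * n + 1)) div (1 - qX)) * q_catalan n * (1 - qX ^ (n + 1))
    = (1 - qX ^ (3 * n + 1)) * gauss_gf n n"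
proof -
  have "(1 - qX) dvd (1 - qX ^ (3 * n + 1))"
    by (metis one_diff_power_eq dvd_triv_left)
  hence "((1 - qX ^ (3 * n + 1)) div (1 - qX)) * (1 - qX) = 1 - qX ^ (3 * n + 1)"
    by simp
  moreover have "d * c * a = p * g" if "a * c = x * g" "d * x = p" for a c d g p x :: "rat poly"
    using that by (metis mult.assoc mult.commute)
  ultimately show ?thesis using q_catalan_mult by blast
qed

text \<open>After multiplication by (1 - q^(n + 1)) (1 - q^(n + 2)) every term becomes a multiple of
  [2n, n], and an identity between the cofactors remains.\<close>

lemma weighted_q_catalan_eq_difference:
  assumes "n = k + 2"
  shows "((1 - qX ^ (3 * n + 1)) div (1 - qX)) * q_catalan n
    = gauss_gf (n + 2) n - qX ^ (n + 2) * gauss_gf (n + 2) k"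
    (is "?T = ?R")
proof -
  let ?a = "1 - qX ^ (n + 1)" and ?b = "1 - qX ^ (n + 2)" and ?g = "gauss_gf n n"
  \<comment> \<open>Composes two neighbour ratios into one step from \<open>x\<close> to
    \<open>z\<close>.\<close>
  have chain: "x * (a * b) = z * (v * u)" if "x * b = y * u" "y * a = z * v"
    for x y z a b u v :: "rat poly"
  proof -
    have "x * (a * b) = (x * b) * a" by (simp only: mult_ac)
    also have "\<dots> = (y * a) * u" unfolding that(1) by (simp only: mult_ac)
    finally show ?thesis unfolding that(2) by (simp only: mult_ac)
  qed
  have 1: "gauss_gf (n + 2) n * (?a * ?b) = ?g * ((1 - qX ^ (2 * n + 1)) * (1 - qX ^ (2 * n + 2)))"
  proof (rule chain)
    show "gauss_gf (n + 2) n * ?b = gauss_gf (n + 1) n * (1 - qX ^ (2 * n + 2))"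
      using gauss_gf_Suc_left[of "n + 1" n] by (simp add: mult_2)
    show "gauss_gf (n + 1) n * ?a = ?g * (1 - qX ^ (2 * n + 1))"
      using gauss_gf_Suc_left[of n n] by (simp add: mult_2)
  qed
  have "gauss_gf (n + 2) k * (?a * ?b) = gauss_gf n k * ((1 - qX ^ (n + k + 1)) * (1 - qX ^ (2 * n)))"
  proof (rule chain)
    show "gauss_gf (n + 2) k * ?b = gauss_gf (n + 1) k * (1 - qX ^ (2 * n))"
      using gauss_gf_Suc_left[of "n + 1" k] assms by (simp add: mult_2)
    show "gauss_gf (n + 1) k * ?a = gauss_gf n k * (1 - qX ^ (n + k + 1))"
      using gauss_gf_Suc_left[of n k] by simp
  qed
  also have "\<dots> = ?g * ((1 - qX ^ (k + 1)) * (1 - qX ^ n))"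
  proof (rule chain[symmetric])
    show "?g * (1 - qX ^ n) = gauss_gf n (k + 1) * (1 - qX ^ (2 * n))"
      using gauss_gf_Suc_right[of n "k + 1"] assms by (simp add: mult_2)
    show "gauss_gf n (k + 1) * (1 - qX ^ (k + 1)) = gauss_gf n k * (1 - qX ^ (n + k + 1))"
      using gauss_gf_Suc_right[of n k] by simp
  qed
  finally have 2: "gauss_gf (n + 2) k * (?a * ?b) = ?g * ((1 - qX ^ (k + 1)) * (1 - qX ^ n))" .
  have "(u - v * w) * z = g * (p - v * r)" if "u * z = g * p" "w * z = g * r"
    for u v w z g p r :: "rat poly"
    using that by (simp add: left_diff_distrib right_diff_distrib mult.assoc mult.left_commute)
  from this[OF 1 2] have "?R * (?a * ?b) = ?g * ((1 - qX ^ (2 * n + 1)) * (1 - qX ^ (2 * n + 2))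
      - qX ^ (n + 2) * ((1 - qX ^ (k + 1)) * (1 - qX ^ n)))" .
  also have "(1 - qX ^ (2 * n + 1)) * (1 - qX ^ (2 * n + 2))
      - qX ^ (n + 2) * ((1 - qX ^ (k + 1)) * (1 - qX ^ n)) = (1 - qX ^ (3 * n + 1)) * ?b"
  proof -
    \<comment> \<open>Applied with Q = q^n, x = q and B = q^(n - 1), so that the symbolic exponents
      disappear.\<close>
    have identity: "(1 - Q * Q * x) * (1 - Q * Q * x\<^sup>2) - Q * x\<^sup>2 * ((1 - B) * (1 - Q))
        = (1 - Q * Q * Q * x) * (1 - Q * x\<^sup>2)" if "Q = x * B" for Q B x :: "rat poly"
      unfolding that by (simp add: algebra_simps power2_eq_square)
    have "qX ^ (2 * n + i) = qX ^ n * qX ^ n * qX ^ i"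
      "qX ^ (3 * n + i) = qX ^ n * qX ^ n * qX ^ n * qX ^ i" for i
      by (simp_all only: power_add[symmetric] mult_2 numeral_3_eq_3 mult_Suc mult_0 add_0_right add_0_left add_ac)
    moreover have "qX ^ n = qX * qX ^ (k + 1)" by (simp add: assms)
    ultimately show ?thesis using identity[of "qX ^ n" qX "qX ^ (k + 1)"]
      by (simp only: power_add[of qX n 2] power_one_right)
  qed
  also have "?g * ((1 - qX ^ (3 * n + 1)) * ?b) = ?T * (?a * ?b)"
    unfolding mult.assoc[symmetric] weighted_q_catalan_mult by (simp only: mult_ac)
  finally have "?R * (?a * ?b) = ?T * (?a * ?b)" .
  moreover have "?a \<noteq> 0" "?b \<noteq> 0" by (rule one_minus_qX_power_neq_0; simp)+
  ultimately show ?thesis by (metis mult_right_cancel mult_eq_0_iff)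
qed

section \<open>Palindromicity, and unimodality from growth up to the middle\<close>

lemma symmetric_poly_if_reflect: "reflect_poly p = p \<Longrightarrow> symmetric_poly p"
  unfolding symmetric_poly_def by (metis coeff_reflect_poly not_less)

lemma unimodal_poly_if_increasing:
  assumes sym: "symmetric_poly p" and deg: "degree p = 2 * m"
    and incr: "\<And>i. i < m \<Longrightarrow> coeff p i \<le> coeff p (i + 1)"
  shows "unimodal_poly p"
  unfolding unimodal_poly_def
proof (intro exI[of _ m] conjI allI impI)
  fix i assume i: "m \<le> i \<and> i < degree p"
  hence "coeff p (degree p - (i + 1)) \<le> coeff p (degree p - (i + 1) + 1)"
    using deg by (intro incr) auto
  moreover have "degree p - (i + 1) + 1 = degree p - i" using i by arith
  ultimately show "coeff p (i + 1) \<le> coeff p i"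
    using sym i unfolding symmetric_poly_def by (metis Suc_eq_plus1 Suc_leI less_imp_le)
qed (use deg incr in auto)

text \<open>Reflecting the identity of \<open>weighted_q_catalan_mult\<close> negates one factor 1 -
  q^m on each side and fixes the Gaussian polynomial; the degree follows from the same
  identity.\<close>

lemma weighted_q_catalan_symmetric:
  fixes n :: nat
  defines "T \<equiv> ((1 - qX ^ (3 * n + 1)) div (1 - qX)) * q_catalan n"
  shows "symmetric_poly T" and "degree T = n * (n + 2)"
proof -
  have T: "T * (1 - qX ^ (n + 1)) = (1 - qX ^ (3 * n + 1)) * gauss_gf n n"
    unfolding T_def by (rule weighted_q_catalan_mult)
  have nz: "1 - qX ^ (n + 1) \<noteq> 0" "1 - qX ^ (3 * n + 1) \<noteq> 0"
    by (rule one_minus_qX_power_neq_0; simp)+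
  have "reflect_poly T * - (1 - qX ^ (n + 1)) = - (1 - qX ^ (3 * n + 1)) * gauss_gf n n"
    using arg_cong[OF T, of reflect_poly] unfolding reflect_poly_mult reflect_gauss_gf
    by (simp only: reflect_one_minus_qX_power)
  hence "reflect_poly T * (1 - qX ^ (n + 1)) = T * (1 - qX ^ (n + 1))"
    unfolding T by (simp only: mult_minus_right mult_minus_left neg_equal_iff_equal)
  hence "reflect_poly T = T" using nz by (metis mult_right_cancel)
  thus "symmetric_poly T" by (rule symmetric_poly_if_reflect)
  have "T \<noteq> 0" using T nz gauss_gf_neq_0 by (metis mult_eq_0_iff)
  hence "degree T + (n + 1) = (3 * n + 1) + n * n"
    using arg_cong[OF T, of degree]
    by (simp only: degree_mult_eq[OF \<open>T \<noteq> 0\<close> nz(1)] degree_mult_eq[OF nz(2) gauss_gf_neq_0]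
        degree_one_minus_qX_power degree_gauss_gf)
  thus "degree T = n * (n + 2)" by simp
qed

theorem theorem1p6:
  fixes n :: nat
  assumes "even n"
  shows "symmetric_poly (((1 - qX ^ (3 * n + 1)) div (1 - qX)) * q_catalan n) \<and>
         unimodal_poly (((1 - qX ^ (3 * n + 1)) div (1 - qX)) * q_catalan n)"
proof
  let ?T = "((1 - qX ^ (3 * n + 1)) div (1 - qX)) * q_catalan n"
  show sym: "symmetric_poly ?T" by (rule weighted_q_catalan_symmetric)
  show "unimodal_poly ?T"
  proof (rule unimodal_poly_if_increasing[OF sym])
    show "degree ?T = 2 * (n * (n + 2) div 2)"
      unfolding weighted_q_catalan_symmetric(2) using assms by simp
  next
    fix i assume i: "i < n * (n + 2) div 2"
    \<comment> \<open>For \<open>n = 0\<close> the range of \<open>i\<close> is empty, so the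
      difference formula is applied only for \<open>n \<ge> 2\<close>.\<close>
    have "n \<noteq> 0" by (rule ccontr) (use i in simp)
    with assms have "2 \<le> n" by presburger
    then obtain k where n: "n = k + 2" using le_Suc_ex by (metis add.commute)
    \<comment> \<open>The power q^(n + 2) shifts weights by \<open>N = n + 2\<close>, the weight of
      \<open>quadric N\<close>; hence \<open>shifted_mons\<close>.\<close>
    have c: "coeff ?T w = of_nat (card (mons (n + 2) (k + 2) w))
        - of_nat (card (shifted_mons (n + 2) k w))" for w
    proof -
      have "qX ^ (n + 2) = monom 1 (n + 2)" by (simp add: monom_altdef)
      thus ?thesis
        unfolding weighted_q_catalan_eq_difference[OF n] coeff_diff coeff_gauss_gf
        by (simp add: coeff_monom_mult coeff_gauss_gf shifted_mons_def n)
    qed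
    have "2 * i < (n + 2) * (k + 2)" using i n by (simp add: mult.commute)
    hence "card (shifted_mons (n + 2) k (Suc i)) + card (mons (n + 2) (k + 2) i)
        \<le> card (mons (n + 2) (k + 2) (Suc i)) + card (shifted_mons (n + 2) k i)"
      using assms by (intro card_mons_increase) auto
    thus "coeff ?T i \<le> coeff ?T (i + 1)"
      unfolding c Suc_eq_plus1 by (simp add: algebra_simps flip: of_nat_add)
  qed
qed

end
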